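(* Let $G=(V,E)$ be a graph, and let $D:V\to\mathbb{N}$ be such that $\deg(G,v)\leq D(v)$ for all $v\in V$. For each $v\in V$, fix a sequence $\mathbf{u}^{(v)}=\{u^{(v)}_0,u^{(v)}_1,u^{(v)}_2,\ldots\}$ of nonnegative real numbers, with generating function $$\Gamma_v(y):=\sum_{k=0}^{D(v)}\binom{D(v)}{k}u^{(v)}_k y^k.$$ Consider the polynomial in the variables $\mathbf{z}=\{z_v: v\in V\}$ $$F(G;\{\mathbf{u}^{(v)}\},\mathbf{z}):=\sum_{H\subseteq E}\mathbf{u}_{\deg(H)}\,\mathbf{z}^{\deg(H)}.$$ (a) Fix $0\leq\alpha<\pi/2$. If $\Gamma_v(y)$ is $\mathcal{S}[\pi-\alpha]$-nonvanishing for all $v\in V$, then $F(G;\{\mathbf{u}^{(v)}\},\mathbf{z})$ is $\mathcal{S}[\pi/2-\alpha]$-nonvanishing. (b) Fix $\kappa>0$. If $\Gamma_v(y)$ is $\kappa\mathcal{D}$-nonvanishing for all $v\in V$, then $F(G;\{\mathbf{u}^{(v)}\},\mathbf{z})$ is $\kappa\mathcal{D}$-nonvanishing. (c) Fix $\kappa>0$. If $D(v)=\deg(G,v)$, $u^{(v)}_{D(v)}\neq 0$, and $\Gamma_v(y)$ is $\kappa\mathcal{E}$-nonvanishing for all $v\in V$, then $F(G;\{\mathbf{u}^{(v)}\},\mathbf{z})$ is $\kappa\mathcal{E}$-nonvanishing.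
   Context: A graph $G=(V,E)$ is a finite undirected multigraph (loops and multiple edges allowed); $\mathbb{N}$ includes $0$. Spanning subgraphs are identified with edge subsets $H\subseteq E$; $\deg(H,v)$ is the degree of $v$ in $(V,H)$, a loop contributing $2$, and $\deg(G,v)=\deg(E,v)$. For $H\subseteq E$, $\mathbf{u}_{\deg(H)}:=\prod_{v\in V}u^{(v)}_{\deg(H,v)}$ and $\mathbf{z}^{\deg(H)}:=\prod_{v\in V}z_v^{\deg(H,v)}$. For an open set $\mathcal{A}\subset\mathbb{C}$, a complex polynomial $F$ in finitely many variables is $\mathcal{A}$-nonvanishing if either $F\equiv 0$, or $F\neq 0$ whenever all variables take values in $\mathcal{A}$. For $0<\theta\leq\pi$, $\mathcal{S}[\theta]:=\{z\in\mathbb{C}: z\neq 0 \text{ and } |\arg(z)|<\theta\}$, with $-\pi<\arg(z)\leq\pi$. For $\kappa>0$, $\kappa\mathcal{D}:=\{z\in\mathbb{C}:|z|<\kappa\}$ and $\kappa\mathcal{E}:=\{z\in\mathbb{C}:|z|>\kappa\}$. *)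

theory Defs
  imports "HOL-Analysis.Analysis" "HOL-Library.Poly_Mapping" "HOL-Library.Uprod"
begin

text \<open>
  Finite undirected multigraphs. Edges are abstract names, so parallel edges are distinct
  elements of \<open>E\<close> with the same endpoints, and a loop at \<open>v\<close> is an edge with
  endpoints \<open>Upair v v\<close>.
\<close>

locale finite_multigraph =
  fixes V :: "'v set" and E :: "'e set" and ends :: "'e \<Rightarrow> 'v uprod"
  assumes finite_V: "finite V"
    and finite_E: "finite E"
    and ends_subset: "\<And>e. e \<in> E \<Longrightarrow> set_uprod (ends e) \<subseteq> V"

definition edge_degree :: "('e \<Rightarrow> 'v uprod) \<Rightarrow> 'e set \<Rightarrow> 'v \<Rightarrow> nat" where
  "edge_degree ends H v =
     (\<Sum>e\<in>H. if ends e = Upair v v then 2 else if v \<in> set_uprod (ends e) then 1 else 0)"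

text \<open>
  Complex polynomials in variables indexed by \<open>'x\<close>: finitely supported maps from monomials
  (finitely supported exponent vectors) to coefficients.
\<close>

type_synonym 'x cpoly = "('x \<Rightarrow>\<^sub>0 nat) \<Rightarrow>\<^sub>0 complex"

definition eval_monom :: "('x \<Rightarrow>\<^sub>0 nat) \<Rightarrow> ('x \<Rightarrow> complex) \<Rightarrow> complex" where
  "eval_monom m z = (\<Prod>x\<in>Poly_Mapping.keys m. z x ^ Poly_Mapping.lookup m x)"

definition eval_cpoly :: "'x cpoly \<Rightarrow> ('x \<Rightarrow> complex) \<Rightarrow> complex" where
  "eval_cpoly p z = (\<Sum>m\<in>Poly_Mapping.keys p. Poly_Mapping.lookup p m * eval_monom m z)"

text \<open>
  Variables that do not occur in \<open>p\<close> do not affect its value, so requiring all of them to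
  lie in the (nonempty) set \<open>A\<close> is no restriction.
\<close>

definition nonvanishing :: "complex set \<Rightarrow> 'x cpoly \<Rightarrow> bool" where
  "nonvanishing A p \<longleftrightarrow> p = 0 \<or> (\<forall>z. (\<forall>x. z x \<in> A) \<longrightarrow> eval_cpoly p z \<noteq> 0)"

definition sector :: "real \<Rightarrow> complex set" where
  "sector \<theta> = {z. z \<noteq> 0 \<and> \<bar>Arg z\<bar> < \<theta>}"

text \<open>
  \<open>vertex_gen d a\<close> is a polynomial in one variable, which is indexed by \<open>() :: unit\<close>.
\<close>

definition vertex_gen :: "nat \<Rightarrow> (nat \<Rightarrow> real) \<Rightarrow> unit cpoly" where
  "vertex_gen d a =
     (\<Sum>k\<le>d. Poly_Mapping.single (Poly_Mapping.single () k) (of_nat (d choose k) * of_real (a k)))"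

definition subgraph_poly ::
  "'v set \<Rightarrow> 'e set \<Rightarrow> ('e \<Rightarrow> 'v uprod) \<Rightarrow> ('v \<Rightarrow> nat \<Rightarrow> real) \<Rightarrow> 'v cpoly" where
  "subgraph_poly V E ends u =
     (\<Sum>H\<in>Pow E. Poly_Mapping.single
        (\<Sum>v\<in>V. Poly_Mapping.single v (edge_degree ends H v))
        (of_real (\<Prod>v\<in>V. u v (edge_degree ends H v))))"

lemma eval_cpoly_superset:
  assumes "finite M" "Poly_Mapping.keys p \<subseteq> M"
  shows "eval_cpoly p z = (\<Sum>m\<in>M. Poly_Mapping.lookup p m * eval_monom m z)"
  unfolding eval_cpoly_def using assms
  by (intro sum.mono_neutral_left) (auto simp: in_keys_iff)

lemma eval_cpoly_zero [simp]: "eval_cpoly 0 z = 0"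
  by (simp add: eval_cpoly_def)

lemma eval_cpoly_add: "eval_cpoly (p + q) z = eval_cpoly p z + eval_cpoly q z"
proof -
  have "Poly_Mapping.keys (p + q) \<subseteq> Poly_Mapping.keys p \<union> Poly_Mapping.keys q" by (rule Poly_Mapping.keys_add)
  then show ?thesis
    by (simp add: eval_cpoly_superset[of "Poly_Mapping.keys p \<union> Poly_Mapping.keys q"] lookup_add distrib_right sum.distrib)
qed

lemma eval_cpoly_sum: "eval_cpoly (\<Sum>i\<in>I. f i) z = (\<Sum>i\<in>I. eval_cpoly (f i) z)"
  by (induction I rule: infinite_finite_induct) (simp_all add: eval_cpoly_add)

lemma eval_cpoly_single [simp]: "eval_cpoly (Poly_Mapping.single m c) z = c * eval_monom m z"
  by (simp add: eval_cpoly_def)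

lemma eval_monom_sum_single:
  assumes "finite V"
  shows "eval_monom (\<Sum>v\<in>V. Poly_Mapping.single v (d v)) z = (\<Prod>v\<in>V. z v ^ d v)"
proof -
  let ?m = "\<Sum>v\<in>V. Poly_Mapping.single v (d v)"
  have l: "Poly_Mapping.lookup ?m x = (if x \<in> V then d x else 0)" for x
    using assms by (simp add: lookup_sum lookup_single when_def sum.delta)
  have "eval_monom ?m z = (\<Prod>v\<in>V. z v ^ Poly_Mapping.lookup ?m v)"
    unfolding eval_monom_def using assms l
    by (intro prod.mono_neutral_left) (auto simp: in_keys_iff split: if_splits)
  then show ?thesis using l by simp
qed

lemma eval_vertex_gen:
  "eval_cpoly (vertex_gen d a) y = (\<Sum>k\<le>d. of_nat (d choose k) * of_real (a k) * y () ^ k)"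
  using eval_monom_sum_single[of "{()}" "\<lambda>_. k" y for k]
  by (simp add: vertex_gen_def eval_cpoly_sum)

lemma eval_subgraph_poly:
  assumes "finite V"
  shows "eval_cpoly (subgraph_poly V E ends u) z =
    (\<Sum>H\<in>Pow E. of_real (\<Prod>v\<in>V. u v (edge_degree ends H v)) *
       (\<Prod>v\<in>V. z v ^ edge_degree ends H v))"
  using assms by (simp add: subgraph_poly_def eval_cpoly_sum eval_monom_sum_single)

end

theory Submission
  imports Defs "HOL-Complex_Analysis.Complex_Analysis"
    "HOL-Computational_Algebra.Fundamental_Theorem_Algebra"
begin

text \<open>
  With all weights equal to \<open>1\<close> the polynomial is the product of \<open>1 + z\<^sub>v z\<^sub>w\<close> over the edges
  \<open>v w\<close>, which does not vanish on the open unit disc nor on the open right half-plane. The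
  weights are introduced one vertex at a time: replacing \<open>z\<^sub>v\<^sup>k\<close> by \<open>u\<^sub>k z\<^sub>v\<^sup>k\<close> is a
  Schur--Szeg\H{o} composition with \<open>\<Gamma>\<^sub>v\<close>, so by Laguerre's theorem on polar derivatives the
  region of \<open>z\<^sub>v\<close> changes to \<open>\<kappa>\<D>\<close>, respectively to \<open>\<S>[\<pi>/2 - \<alpha>]\<close>, while the regions of the
  other variables are kept. Weighted vertices thus stay in the small sector and unweighted ones
  in the half-plane, which is why the angle \<open>\<alpha>\<close> is lost only once.
  Part (c) follows from (b) by complementing \<open>H\<close> in \<open>E\<close>.
\<close>

section \<open>Polynomials with binomially normalised coefficients\<close>

text \<open>In this normalisation, with \<open>n\<close> as formal degree, reversal and polar
  derivatives act on the sequence \<open>g\<close> alone.\<close>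

definition binom_poly :: "nat \<Rightarrow> (nat \<Rightarrow> complex) \<Rightarrow> complex poly" where
  "binom_poly n g = (\<Sum>k\<le>n. monom (of_nat (n choose k) * g k) k)"

lemma coeff_binom_poly: "coeff (binom_poly n g) k = of_nat (n choose k) * g k"
  by (cases "k \<le> n") (auto simp: binom_poly_def coeff_sum coeff_monom)

lemma degree_binom_poly_le: "degree (binom_poly n g) \<le> n"
  by (rule degree_le) (simp add: coeff_binom_poly)

lemma poly_binom_poly: "poly (binom_poly n g) x = (\<Sum>k\<le>n. of_nat (n choose k) * g k * x ^ k)"
  by (simp add: binom_poly_def poly_sum poly_monom)

lemma poly_binom_poly_reverse:
  assumes "x \<noteq> 0"
  shows "poly (binom_poly n (\<lambda>k. g (n - k))) x = x ^ n * poly (binom_poly n g) (1 / x)"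
proof -
  have "poly (binom_poly n (\<lambda>k. g (n - k))) x = (\<Sum>k\<le>n. of_nat (n choose k) * g k * x ^ (n - k))"
    unfolding poly_binom_poly
    by (rule sum.reindex_bij_witness[of _ "\<lambda>k. n - k" "\<lambda>k. n - k"])
      (auto simp: binomial_symmetric[symmetric])
  also have "\<dots> = x ^ n * poly (binom_poly n g) (1 / x)"
    using assms by (simp add: poly_binom_poly sum_distrib_left power_diff power_one_over field_simps)
  finally show ?thesis .
qed

text \<open>With \<open>p = binom_poly (Suc n) g\<close>, the right-hand side is the polar
  derivative \<open>(n + 1) p + (\<zeta> - x) p'\<close>. Coefficients agree by the absorption
  identities for binomial coefficients.\<close>

lemma binom_poly_polar:
  "smult (of_nat (Suc n)) (binom_poly n (\<lambda>k. g k + \<zeta> * g (Suc k))) =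
   smult (of_nat (Suc n)) (binom_poly (Suc n) g) + [:\<zeta>, -1:] * pderiv (binom_poly (Suc n) g)"
proof (rule poly_eqI)
  fix k
  have S: "of_nat (Suc n) * of_nat (n choose k) =
      (of_nat (Suc k) * of_nat (Suc n choose Suc k) :: complex)"
    by (metis Suc_times_binomial_eq mult.commute of_nat_mult)
  \<comment> \<open>This is \<open>(n + 1 - k) * (n + 1 choose k) = (n + 1) * (n choose k)\<close>,
    written without subtraction.\<close>
  have R: "of_nat (Suc n) * of_nat (n choose k) + of_nat k * of_nat (Suc n choose k) =
      (of_nat (Suc n) * of_nat (Suc n choose k) :: complex)"
  proof (cases k)
    case (Suc j)
    have "Suc n * (n choose k) + k * (Suc n choose k) = Suc n * (Suc n choose k)"
      using Suc_times_binomial_eq[of n j] by (simp add: Suc algebra_simps)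
    then show ?thesis
      by (metis of_nat_add of_nat_mult)
  qed simp
  have D: "coeff (pCons 0 (pderiv p)) k = of_nat k * coeff p k" for p :: "complex poly"
    by (cases k) (simp_all add: coeff_pderiv)
  have "[:\<zeta>, -1:] * p = smult \<zeta> p - pCons 0 p" for p :: "complex poly"
    by simp
  then have "coeff (smult (of_nat (Suc n)) (binom_poly (Suc n) g) + [:\<zeta>, -1:] * pderiv (binom_poly (Suc n) g)) k =
    of_nat (Suc n) * (of_nat (Suc n choose k) * g k)
      + (\<zeta> * (of_nat (Suc k) * (of_nat (Suc n choose Suc k) * g (Suc k)))
      - of_nat k * (of_nat (Suc n choose k) * g k))"
    by (simp only: coeff_add coeff_smult coeff_diff coeff_binom_poly D coeff_pderiv)
  also have "\<dots> = (of_nat (Suc n) * of_nat (Suc n choose k) - of_nat k * of_nat (Suc n choose k)) * g k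
      + \<zeta> * (of_nat (Suc k) * of_nat (Suc n choose Suc k)) * g (Suc k)"
    by (simp only: algebra_simps)
  also have "\<dots> = of_nat (Suc n) * of_nat (n choose k) * (g k + \<zeta> * g (Suc k))"
    unfolding S[symmetric] R[symmetric] by (simp only: algebra_simps)
  finally show "coeff (smult (of_nat (Suc n)) (binom_poly n (\<lambda>k. g k + \<zeta> * g (Suc k)))) k =
    coeff (smult (of_nat (Suc n)) (binom_poly (Suc n) g) + [:\<zeta>, -1:] * pderiv (binom_poly (Suc n) g)) k"
    by (simp only: coeff_smult coeff_binom_poly mult.assoc)
qed

section \<open>Laguerre's theorem on polar derivatives\<close>

lemma complex_poly_factors:
  fixes p :: "complex poly"
  obtains r where "p = smult (lead_coeff p) (\<Prod>i<degree p. [:- r i, 1:])"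
proof -
  obtain xs where xs: "mset xs = proots p"
    using ex_mset by blast
  have len: "length xs = degree p"
    using xs by (metis size_mset size_proots_complex)
  have "p = smult (lead_coeff p) (\<Prod>x\<leftarrow>xs. [:- x, 1:])"
    using complex_poly_decompose_multiset[of p] by (metis xs mset_map prod_mset_prod_list)
  also have "(\<Prod>x\<leftarrow>xs. [:- x, 1:]) = (\<Prod>i<degree p. [:- (xs ! i), 1:])"
    by (simp add: prod.list_conv_set_nth len atLeast0LessThan)
  finally show thesis
    using that by blast
qed

text \<open>Logarithmic derivative of a product; indexing the factors lets roots repeat.\<close>

lemma poly_pderiv_prod_linear:
  fixes r :: "'a \<Rightarrow> complex"
  assumes "finite I" "\<And>i. i \<in> I \<Longrightarrow> s \<noteq> r i"
  shows "poly (pderiv (\<Prod>i\<in>I. [:- r i, 1:])) s =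
         poly (\<Prod>i\<in>I. [:- r i, 1:]) s * (\<Sum>i\<in>I. 1 / (s - r i))"
  using assms
proof (induction I rule: finite_induct)
  case (insert i I)
  let ?P = "\<Prod>i\<in>I. [:- r i, 1:]" and ?S = "\<Sum>i\<in>I. 1 / (s - r i)"
  have ne: "s - r i \<noteq> 0"
    using insert.prems by auto
  have "poly (pderiv (\<Prod>i\<in>insert i I. [:- r i, 1:])) s = poly ?P s + (s - r i) * poly (pderiv ?P) s"
    using insert.hyps by (simp add: pderiv_mult pderiv_pCons del: mult_pCons_left)
  also have "poly (pderiv ?P) s = poly ?P s * ?S"
    using insert by simp
  also have "poly ?P s + (s - r i) * (poly ?P s * ?S) = (s - r i) * poly ?P s * (1 / (s - r i) + ?S)"
    using ne by (simp add: distrib_left)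
  finally show ?case
    using insert.hyps by (simp del: mult_pCons_left)
qed simp

text \<open>For \<open>a \<ge> 0\<close> the set where this is \<open>\<le> 0\<close> is a closed disc, or a closed half-plane if \<open>a = 0\<close>.\<close>

definition circ_form :: "real \<Rightarrow> complex \<Rightarrow> real \<Rightarrow> complex \<Rightarrow> real" where
  "circ_form a b d x = a * (cmod x)\<^sup>2 + 2 * Re (b * x) + d"

text \<open>Inversion \<open>r \<mapsto> 1 / (s - r)\<close> carries generalised circles to
  generalised circles. The leading coefficient of the new form is the value of the old one at
  \<open>s\<close>, so the new form is concave when \<open>s\<close> lies in the region.\<close>

lemma circ_form_inverse_diff:
  assumes "s \<noteq> r"
  shows "circ_form (circ_form a b d s) (- (of_real a * s + cnj b)) a (1 / (s - r)) =
         circ_form a b d r / (cmod (s - r))\<^sup>2"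
proof -
  define h where "h = s - r"
  have h: "h \<noteq> 0" and r: "r = s - h"
    using assms by (auto simp: h_def)
  have n: "(cmod h)\<^sup>2 \<noteq> 0"
    using h by simp
  have "1 / h = of_real (1 / (cmod h)\<^sup>2) * cnj h"
    using h by (simp add: complex_div_cnj[of 1 h] complex_norm_square)
  then have *: "Re (c * (1 / h)) = Re (c * cnj h) / (cmod h)\<^sup>2" for c
    by (simp add: field_simps)
  have m: "(cmod (1 / h))\<^sup>2 = 1 / (cmod h)\<^sup>2"
    by (simp add: norm_divide power_divide)
  have "circ_form a b d s + 2 * Re (- (of_real a * s + cnj b) * cnj h) + a * (cmod h)\<^sup>2 = circ_form a b d r"
    unfolding r circ_form_def unfolding cmod_power2 by (simp add: power2_eq_square algebra_simps)
  moreover have "circ_form (circ_form a b d s) (- (of_real a * s + cnj b)) a (1 / h) =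
    (circ_form a b d s + 2 * Re (- (of_real a * s + cnj b) * cnj h) + a * (cmod h)\<^sup>2) / (cmod h)\<^sup>2"
    unfolding circ_form_def[of _ _ _ "1 / h"] * m using n by (simp add: add_divide_distrib diff_divide_distrib)
  ultimately show ?thesis
    by (simp add: h_def)
qed

text \<open>
  The reciprocals \<open>1 / (s - r)\<close> of the points \<open>r\<close> outside the disc or half-plane form a
  convex set whose closure contains \<open>0\<close>, hence it contains the average of
  \<open>1 / (s - r\<^sub>j)\<close> over the roots, padded by zeros for the missing degree.
\<close>

lemma laguerre_circular:
  assumes a: "0 \<le> a"
    and nz: "\<And>s. circ_form a b d s \<le> 0 \<Longrightarrow> poly p s \<noteq> 0"
    and deg: "degree p \<le> n" and n: "0 < n"
    and \<zeta>: "circ_form a b d \<zeta> \<le> 0" and s: "circ_form a b d s \<le> 0"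
  shows "of_nat n * poly p s + (\<zeta> - s) * poly (pderiv p) s \<noteq> 0"
proof
  assume eq: "of_nat n * poly p s + (\<zeta> - s) * poly (pderiv p) s = 0"
  have ps: "poly p s \<noteq> 0"
    using nz s by blast
  obtain r where r: "p = smult (lead_coeff p) (\<Prod>i<degree p. [:- r i, 1:])"
    by (rule complex_poly_factors)
  have p0: "poly p x = lead_coeff p * (\<Prod>i<degree p. x - r i)" for x
    by (subst r) (simp add: poly_prod)
  have root: "poly p (r i) = 0" if "i < degree p" for i
    unfolding p0 using that by auto
  have sr: "s \<noteq> r i" if "i < degree p" for i
    using root[OF that] ps by auto
  define w where "w i = 1 / (s - r i)" for i
  define W where "W = (\<Sum>i<degree p. w i)"
  have pd: "poly (pderiv p) s = poly p s * W"
  proof -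
    have "poly (pderiv p) s = lead_coeff p * poly (pderiv (\<Prod>i<degree p. [:- r i, 1:])) s"
      by (subst r) (simp add: pderiv_smult)
    also have "\<dots> = lead_coeff p * poly (\<Prod>i<degree p. [:- r i, 1:]) s * W"
      using poly_pderiv_prod_linear[of "{..<degree p}" s r] sr by (simp add: W_def w_def)
    also have "lead_coeff p * poly (\<Prod>i<degree p. [:- r i, 1:]) s = poly p s"
      by (subst (3) r) simp
    finally show ?thesis .
  qed
  \<comment> \<open>Dividing by \<open>poly p s\<close> shows that the padded average
    \<open>W / n\<close> equals \<open>1 / (s - \<zeta>)\<close>. Positivity of the transformed form
    at this average will put \<open>\<zeta>\<close> outside the region.\<close>
  have "poly p s * (of_nat n + (\<zeta> - s) * W) = 0"
    using eq unfolding pd by (simp add: algebra_simps)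
  with ps have "of_nat n + (\<zeta> - s) * W = 0"
    by simp
  then have nW: "of_nat n = (s - \<zeta>) * W"
    by (simp add: algebra_simps)
  with n have s\<zeta>: "s \<noteq> \<zeta>" and "W \<noteq> 0"
    by auto
  \<comment> \<open>At least one root is needed for the sum of the form over the roots to be
    strictly positive.\<close>
  then have d0: "0 < degree p"
    unfolding W_def by (cases "degree p") auto
  define q e where "q = circ_form a b d s" and "e = - (of_real a * s + cnj b)"
  have q: "q \<le> 0"
    using s by (simp add: q_def)
  have pos: "0 < circ_form q e a (w i)" if "i < degree p" for i
  proof -
    have "0 < circ_form a b d (r i)"
      using nz[of "r i"] root[OF that] by force
    then show ?thesis
      unfolding w_def q_def e_def circ_form_inverse_diff[OF sr[OF that]]
      using sr[OF that] by simp
  qed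
  have ReW: "Re (e * W) = (\<Sum>i<degree p. Re (e * w i))"
    by (simp only: W_def sum_distrib_left Re_sum)
  have "0 < (\<Sum>i<degree p. circ_form q e a (w i))"
    using d0 pos by (intro sum_pos) auto
  also have "\<dots> = q * (\<Sum>i<degree p. (cmod (w i))\<^sup>2) + 2 * Re (e * W) + degree p * a"
    unfolding circ_form_def sum.distrib sum_distrib_left[symmetric] ReW by simp
  \<comment> \<open>Jensen's inequality for the concave form, by Cauchy-Schwarz and
    \<open>q \<le> 0\<close>. Each of the \<open>n - degree p\<close> padding zeros contributes the
    value \<open>a \<ge> 0\<close>.\<close>
  also have "\<dots> \<le> q * ((cmod W)\<^sup>2 / n) + 2 * Re (e * W) + n * a"
  proof -
    have "(cmod W)\<^sup>2 \<le> (\<Sum>i<degree p. cmod (w i))\<^sup>2"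
      unfolding W_def by (intro power_mono norm_sum) auto
    also have "\<dots> \<le> (\<Sum>i<degree p. (cmod (w i))\<^sup>2) * degree p"
      using sum_squared_le_sum_of_squares[of "\<lambda>i. cmod (w i)" "{..<degree p}"] by simp
    also have "\<dots> \<le> (\<Sum>i<degree p. (cmod (w i))\<^sup>2) * n"
      using deg by (intro mult_left_mono sum_nonneg) auto
    finally have "(cmod W)\<^sup>2 / n \<le> (\<Sum>i<degree p. (cmod (w i))\<^sup>2)"
      using n by (simp add: field_simps)
    then have "q * (\<Sum>i<degree p. (cmod (w i))\<^sup>2) \<le> q * ((cmod W)\<^sup>2 / n)"
      using q by (rule mult_left_mono_neg)
    moreover have "degree p * a \<le> n * a"
      using deg a by (intro mult_right_mono) auto
    ultimately show ?thesis by linarith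
  qed
  also have "\<dots> = n * circ_form q e a (W / of_nat n)"
    using n by (simp add: circ_form_def norm_divide power_divide field_simps power2_eq_square)
  also have "W / of_nat n = 1 / (s - \<zeta>)"
    using nW n s\<zeta> by (simp add: field_simps)
  finally have "0 < circ_form q e a (1 / (s - \<zeta>))"
    using n by (simp add: zero_less_mult_iff)
  also have "\<dots> = circ_form a b d \<zeta> / (cmod (s - \<zeta>))\<^sup>2"
    unfolding q_def e_def by (rule circ_form_inverse_diff[OF s\<zeta>])
  also have "\<dots> \<le> 0"
    using \<zeta> by (simp add: divide_nonpos_nonneg)
  finally show False by simp
qed

section \<open>Grace-Walsh-Szego and Schur-Szego composition\<close>

lemma binom_poly_polar_nonzero:
  assumes "0 \<le> a"
    and "\<And>s. circ_form a b d s \<le> 0 \<Longrightarrow> poly (binom_poly (Suc n) g) s \<noteq> 0"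
    and "circ_form a b d \<zeta> \<le> 0" and "circ_form a b d s \<le> 0"
  shows "poly (binom_poly n (\<lambda>k. g k + \<zeta> * g (Suc k))) s \<noteq> 0"
proof
  assume "poly (binom_poly n (\<lambda>k. g k + \<zeta> * g (Suc k))) s = 0"
  then have "poly (smult (of_nat (Suc n)) (binom_poly n (\<lambda>k. g k + \<zeta> * g (Suc k)))) s = 0"
    by (simp only: poly_smult mult_zero_right)
  then show False
    using laguerre_circular[OF assms(1,2) degree_binom_poly_le _ assms(3,4)]
    unfolding binom_poly_polar by (simp add: algebra_simps)
qed

text \<open>
  Grace--Walsh--Szeg\H{o}: the sum is the polarisation of \<open>binom_poly n g\<close> evaluated at
  \<open>\<zeta> 0, \<dots>, \<zeta> (n - 1)\<close>.
\<close>

lemma grace_pairing_nonzero: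
  assumes "0 \<le> a"
    and "\<And>s. circ_form a b d s \<le> 0 \<Longrightarrow> poly (binom_poly n g) s \<noteq> 0"
    and "\<And>i. i < n \<Longrightarrow> circ_form a b d (\<zeta> i) \<le> 0"
    and "circ_form a b d s0 \<le> 0"
  shows "(\<Sum>k\<le>n. g k * coeff (\<Prod>i<n. [:1, \<zeta> i:]) k) \<noteq> 0"
  using assms(2,3)
proof (induction n arbitrary: g)
  case 0
  \<comment> \<open>With no points left, the element \<open>s0\<close> of the region shows that the
    constant \<open>g 0\<close> is nonzero.\<close>
  from 0(1)[OF assms(4)] show ?case by (simp add: poly_binom_poly)
next
  case (Suc n)
  define f where "f = (\<Prod>i<n. [:1, \<zeta> i:])"
  have "degree f \<le> (\<Sum>i<n. degree [:1, \<zeta> i:])"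
    unfolding f_def by (rule order_trans[OF degree_prod_sum_le]) auto
  also have "\<dots> \<le> (\<Sum>i<n. 1)"
    by (intro sum_mono) simp
  finally have deg: "coeff f (Suc n) = 0"
    by (intro coeff_eq_0) simp
  \<comment> \<open>The polar derivative with respect to \<open>\<zeta> n\<close> absorbs one point.
    Moving the shift from \<open>g\<close> to \<open>f\<close> then multiplies \<open>f\<close> by
    the factor \<open>1 + \<zeta> n * x\<close>.\<close>
  have "(\<Sum>k\<le>n. (g k + \<zeta> n * g (Suc k)) * coeff f k) \<noteq> 0"
    unfolding f_def
  proof (rule Suc.IH)
    show "poly (binom_poly n (\<lambda>k. g k + \<zeta> n * g (Suc k))) s \<noteq> 0" if "circ_form a b d s \<le> 0" for s
      using binom_poly_polar_nonzero[OF assms(1) Suc.prems(1) _ that] Suc.prems(2) by blast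
  qed (use Suc.prems in auto)
  also have "(\<Sum>k\<le>n. (g k + \<zeta> n * g (Suc k)) * coeff f k) =
      (\<Sum>k\<le>Suc n. g k * coeff f k) + (\<Sum>k\<le>n. g (Suc k) * (\<zeta> n * coeff f k))"
    using deg by (simp add: sum.distrib distrib_right algebra_simps)
  also have "(\<Sum>k\<le>n. g (Suc k) * (\<zeta> n * coeff f k)) =
      (\<Sum>k\<le>Suc n. g k * coeff (pCons 0 (smult (\<zeta> n) f)) k)"
    by (simp add: sum.atMost_Suc_shift del: sum.atMost_Suc)
  also have "(\<Sum>k\<le>Suc n. g k * coeff f k) + \<dots> =
      (\<Sum>k\<le>Suc n. g k * coeff (f + pCons 0 (smult (\<zeta> n) f)) k)"
    by (simp only: coeff_add distrib_left sum.distrib)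
  also have "f + pCons 0 (smult (\<zeta> n) f) = (\<Prod>i<Suc n. [:1, \<zeta> i:])"
    by (simp add: f_def mult.commute)
  finally show ?case .
qed

text \<open>The Schur--Szeg\H{o} composition theorem; the \<open>n - degree f\<close> zeros of \<open>f\<close> at infinity correspond to the point \<open>0\<close>.\<close>

lemma schur_szego_nonzero:
  assumes "0 \<le> a" and "circ_form a b d 0 \<le> 0"
    and g: "\<And>s. circ_form a b d s \<le> 0 \<Longrightarrow> poly (binom_poly n g) s \<noteq> 0"
    and deg: "degree f \<le> n" and f0: "poly f 0 \<noteq> 0"
    and root: "\<And>x. poly f x = 0 \<Longrightarrow> circ_form a b d (- 1 / x) \<le> 0"
  shows "(\<Sum>k\<le>n. g k * coeff f k) \<noteq> 0"
proof -
  obtain r where r: "f = smult (lead_coeff f) (\<Prod>i<degree f. [:- r i, 1:])"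
    by (rule complex_poly_factors)
  have p: "poly f x = lead_coeff f * (\<Prod>i<degree f. x - r i)" for x
    by (subst r) (simp add: poly_prod)
  have rt: "poly f (r i) = 0" if "i < degree f" for i
    unfolding p using that by auto
  have r0: "r i \<noteq> 0" if "i < degree f" for i
    using rt[OF that] f0 by auto
  \<comment> \<open>\<open>1 + \<zeta> i * x\<close> has the root \<open>r i\<close>; the default 0
    gives the factor 1, so the product can be extended to \<open>n\<close> factors.\<close>
  define \<zeta> where "\<zeta> i = (if i < degree f then - 1 / r i else 0)" for i
  have "(\<Prod>i<degree f. [:- r i, 1:]) = (\<Prod>i<degree f. smult (- r i) [:1, \<zeta> i:])"
    using r0 by (intro prod.cong) (auto simp: \<zeta>_def)
  then have "f = smult (lead_coeff f * (\<Prod>i<degree f. - r i)) (\<Prod>i<degree f. [:1, \<zeta> i:])"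
    by (subst r) (simp only: prod_smult smult_smult)
  also have "lead_coeff f * (\<Prod>i<degree f. - r i) = poly f 0"
    using p[of 0] by simp
  also have "(\<Prod>i<degree f. [:1, \<zeta> i:]) = (\<Prod>i<n. [:1, \<zeta> i:])"
    using deg by (intro prod.mono_neutral_left) (auto simp: \<zeta>_def one_pCons)
  finally have fe: "f = smult (poly f 0) (\<Prod>i<n. [:1, \<zeta> i:])" .
  have "(\<Sum>k\<le>n. g k * coeff (\<Prod>i<n. [:1, \<zeta> i:]) k) \<noteq> 0"
    by (rule grace_pairing_nonzero[OF assms(1) g _ assms(2)])
      (use rt root assms(2) in \<open>auto simp: \<zeta>_def\<close>)
  moreover have "(\<Sum>k\<le>n. g k * coeff f k) = poly f 0 * (\<Sum>k\<le>n. g k * coeff (\<Prod>i<n. [:1, \<zeta> i:]) k)"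
    by (subst fe) (simp add: sum_distrib_left algebra_simps)
  ultimately show ?thesis
    using f0 by simp
qed


section \<open>Introducing the weights vertex by vertex\<close>

text \<open>
  Only the vertices in \<open>W\<close> carry weights: \<open>W = V\<close> gives the subgraph polynomial, while
  \<open>W = {}\<close> gives a product over the edges.
\<close>

definition stage_sum ::
  "'v set \<Rightarrow> 'e set \<Rightarrow> ('e \<Rightarrow> 'v uprod) \<Rightarrow> 'v set \<Rightarrow> ('v \<Rightarrow> nat \<Rightarrow> complex) \<Rightarrow> ('v \<Rightarrow> complex) \<Rightarrow> complex"
where
  "stage_sum V E ends W u z =
     (\<Sum>H\<in>Pow E. (\<Prod>v\<in>W. u v (edge_degree ends H v)) * (\<Prod>v\<in>V. z v ^ edge_degree ends H v))"

lemma edge_degree_mono: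
  assumes "finite E" "H \<subseteq> E"
  shows "edge_degree ends H v \<le> edge_degree ends E v"
  unfolding edge_degree_def using assms by (intro sum_mono2) auto

lemma edge_degree_Diff:
  assumes "finite E" "H \<subseteq> E"
  shows "edge_degree ends (E - H) v = edge_degree ends E v - edge_degree ends H v"
  unfolding edge_degree_def using assms by (intro sum_diff_nat) (auto intro: finite_subset)

lemma edge_degree_sum_singleton: "edge_degree ends H v = (\<Sum>e\<in>H. edge_degree ends {e} v)"
  by (simp add: edge_degree_def)

text \<open>A loop has degree 2 at its vertex, so its factor is the square that \<open>x = y\<close>
  demands.\<close>

lemma prod_edge_degree_Upair:
  fixes z :: "'v \<Rightarrow> 'a::comm_semiring_1"
  assumes "finite V" "x \<in> V" "y \<in> V" and e: "ends e = Upair x y"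
  shows "(\<Prod>v\<in>V. z v ^ edge_degree ends {e} v) = z x * z y"
proof -
  have "(\<Prod>v\<in>V. z v ^ edge_degree ends {e} v) = (\<Prod>v\<in>{x, y}. z v ^ edge_degree ends {e} v)"
    using assms by (intro prod.mono_neutral_right) (auto simp: edge_degree_def)
  also have "\<dots> = z x * z y"
    by (cases "x = y") (auto simp: e edge_degree_def power2_eq_square)
  finally show ?thesis .
qed

text \<open>Degrees add over edges, so the sum over subsets is an expanded product.\<close>

lemma stage_sum_empty:
  assumes "finite E"
  shows "stage_sum V E ends {} u z = (\<Prod>e\<in>E. 1 + (\<Prod>v\<in>V. z v ^ edge_degree ends {e} v))"
proof -
  have *: "(\<Prod>v\<in>V. z v ^ edge_degree ends H v) = (\<Prod>e\<in>H. \<Prod>v\<in>V. z v ^ edge_degree ends {e} v)" for H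
    by (subst edge_degree_sum_singleton, simp only: power_sum) (rule prod.swap)
  have "stage_sum V E ends {} u z = (\<Sum>H\<in>Pow E. \<Prod>e\<in>H. \<Prod>v\<in>V. z v ^ edge_degree ends {e} v)"
    unfolding stage_sum_def by (intro sum.cong refl) (subst *, simp only: prod.empty mult_1_left)
  then show ?thesis
    using prod_add[OF assms, of "\<lambda>e. \<Prod>v\<in>V. z v ^ edge_degree ends {e} v" "\<lambda>_. 1"]
    by (simp add: add.commute)
qed

text \<open>By linearity of the pairing, terms with equal exponents need not be collected; each
  monomial simply receives the weight of its exponent.\<close>

lemma sum_coeff_sum_monom:
  assumes "finite I" "\<And>i. i \<in> I \<Longrightarrow> d i \<le> n"
  shows "(\<Sum>k\<le>n. g k * coeff (\<Sum>i\<in>I. monom (c i) (d i)) k) = (\<Sum>i\<in>I. g (d i) * (c i :: 'a::comm_semiring_1))"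
proof -
  have "(\<Sum>k\<le>n. g k * coeff (\<Sum>i\<in>I. monom (c i) (d i)) k) =
      (\<Sum>i\<in>I. \<Sum>k\<le>n. if d i = k then g k * c i else 0)"
    unfolding coeff_sum sum_distrib_left
    by (subst sum.swap) (intro sum.cong refl, simp)
  also have "\<dots> = (\<Sum>i\<in>I. g (d i) * c i)"
    using assms by (intro sum.cong refl) simp
  finally show ?thesis .
qed

text \<open>Unweighted variables range over \<open>R\<close>, weighted ones over \<open>R'\<close>.
  Before a vertex is weighted, the sum has no zero in \<open>R\<close> as a polynomial in its
  variable, so \<open>-1 / x\<close> sends every root into the circular region. There the rescaled
  generating function is zero-free, and the composition theorem applies.\<close>

lemma stage_sum_nonzero:
  assumes graph: "finite_multigraph V E ends"
    and deg: "\<And>v. v \<in> V \<Longrightarrow> edge_degree ends E v \<le> D v"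
    and a: "0 \<le> a" and C0: "circ_form a b d 0 \<le> 0"
    and R0: "0 \<in> R"
    and RC: "\<And>x. x \<notin> R \<Longrightarrow> circ_form a b d (- 1 / x) \<le> 0"
    and RR: "\<And>x y. x \<in> R \<Longrightarrow> y \<in> R \<Longrightarrow> x * y \<noteq> - 1"
    and gen: "\<And>v x s. v \<in> V \<Longrightarrow> x \<in> R' \<Longrightarrow> circ_form a b d s \<le> 0 \<Longrightarrow>
                poly (binom_poly (D v) (u v)) (x * s) \<noteq> 0"
    and "W \<subseteq> V"
    and "\<And>v. v \<in> W \<Longrightarrow> z v \<in> R'" and "\<And>v. v \<in> V - W \<Longrightarrow> z v \<in> R"
  shows "stage_sum V E ends W u z \<noteq> 0"
proof -
  interpret finite_multigraph V E ends by fact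
  have "finite W"
    using \<open>W \<subseteq> V\<close> finite_V finite_subset by blast
  then show ?thesis
    using assms(9-)
  proof (induction W arbitrary: z rule: finite_induct)
    case empty
    have "1 + (\<Prod>v\<in>V. z v ^ edge_degree ends {e} v) \<noteq> 0" if e: "e \<in> E" for e
    proof -
      obtain x y where xy: "ends e = Upair x y"
        by (cases "ends e")
      then have V: "x \<in> V" "y \<in> V"
        using ends_subset[OF e] by auto
      then have "z x * z y \<noteq> - 1"
        using RR empty.prems by auto
      then show ?thesis
        unfolding prod_edge_degree_Upair[of V x y ends e, OF finite_V V xy]
        by (metis add.commute eq_neg_iff_add_eq_0)
    qed
    then show ?case
      by (simp add: stage_sum_empty finite_E)
  next
    case (insert v W)
    then have v: "v \<in> V" by auto
    \<comment> \<open>\<open>c H\<close> collects what does not involve the variable of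
      \<open>v\<close>; \<open>f\<close> is the previous stage as a polynomial in that variable, the
      others being fixed.\<close>
    define c where "c H = (\<Prod>w\<in>W. u w (edge_degree ends H w)) *
      (\<Prod>w\<in>V - {v}. z w ^ edge_degree ends H w)" for H
    define f where "f = (\<Sum>H\<in>Pow E. monom (c H) (edge_degree ends H v))"
    have dH: "edge_degree ends H v \<le> D v" if "H \<in> Pow E" for H
      using edge_degree_mono[OF finite_E, of H ends v] deg[OF v] that by auto
    have f: "poly f x = stage_sum V E ends W u (z(v := x))" for x
    proof -
      have "(\<Prod>w\<in>V. (z(v := x)) w ^ edge_degree ends H w) =
        x ^ edge_degree ends H v * (\<Prod>w\<in>V - {v}. z w ^ edge_degree ends H w)" for H
        by (subst prod.remove[OF finite_V v]) (auto intro!: prod.cong)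
      then show ?thesis
        by (simp add: f_def c_def stage_sum_def poly_sum poly_monom mult_ac)
    qed
    have fR: "poly f x \<noteq> 0" if "x \<in> R" for x
      unfolding f using insert.prems insert.hyps that by (intro insert.IH) auto
    \<comment> \<open>The value \<open>z v\<close> is absorbed into the coefficient sequence, which
      turns the generating function into \<open>s \<mapsto> \<Gamma> (z v * s)\<close>.\<close>
    have "(\<Sum>k\<le>D v. (u v k * z v ^ k) * coeff f k) \<noteq> 0"
    proof (rule schur_szego_nonzero[OF a C0])
      show "poly (binom_poly (D v) (\<lambda>k. u v k * z v ^ k)) s \<noteq> 0" if "circ_form a b d s \<le> 0" for s
        using gen[OF v insert.prems(2) that, of v]
        by (simp add: poly_binom_poly power_mult_distrib algebra_simps)
      show "degree f \<le> D v"
        unfolding f_def by (intro degree_sum_le order_trans[OF degree_monom_le dH]) (simp add: finite_E)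
      show "poly f 0 \<noteq> 0"
        using fR R0 .
      show "circ_form a b d (- 1 / x) \<le> 0" if "poly f x = 0" for x
        using RC fR that by blast
    qed
    also have "(\<Sum>k\<le>D v. (u v k * z v ^ k) * coeff f k) =
        (\<Sum>H\<in>Pow E. u v (edge_degree ends H v) * z v ^ edge_degree ends H v * c H)"
      unfolding f_def using dH by (intro sum_coeff_sum_monom) (simp_all add: finite_E)
    also have "\<dots> = stage_sum V E ends (insert v W) u z"
      unfolding stage_sum_def c_def using insert.hyps
      by (intro sum.cong refl) (simp add: prod.remove[OF finite_V v] mult_ac)
    finally show ?case .
  qed
qed

section \<open>Passage from formal polynomials to stage sums\<close>

lemma eval_subgraph_poly_stage:
  assumes "finite V"
  shows "eval_cpoly (subgraph_poly V E ends u) z =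
    stage_sum V E ends V (\<lambda>v k. of_real (u v k)) z"
  by (simp add: eval_subgraph_poly[OF assms] stage_sum_def)

lemma eval_vertex_gen_binom_poly:
  "eval_cpoly (vertex_gen d a) y = poly (binom_poly d (\<lambda>k. of_real (a k))) (y ())"
  by (simp add: eval_vertex_gen poly_binom_poly)

lemma vertex_gen_nonvanishingD:
  assumes "nonvanishing A (vertex_gen d a)" "vertex_gen d a \<noteq> 0" "y \<in> A"
  shows "poly (binom_poly d (\<lambda>k. of_real (a k))) y \<noteq> 0"
proof -
  have "eval_cpoly (vertex_gen d a) (\<lambda>_. y) \<noteq> 0"
    using assms unfolding nonvanishing_def by (elim disjE; simp)
  then show ?thesis
    by (simp add: eval_vertex_gen_binom_poly)
qed

text \<open>The value at 1 is a sum of nonnegative terms, and \<open>d choose k\<close> is positive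
  for \<open>k \<le> d\<close>.\<close>

lemma vertex_gen_eq_0D:
  assumes "vertex_gen d a = 0" "\<And>k. 0 \<le> a k" "k \<le> d"
  shows "a k = 0"
proof -
  have "(\<Sum>k\<le>d. of_real (of_nat (d choose k) * a k) :: complex) = 0"
    using eval_vertex_gen[of d a "\<lambda>_. 1"] by (simp add: assms(1))
  then have "(\<Sum>k\<le>d. of_nat (d choose k) * a k) = 0"
    by (simp only: of_real_sum[symmetric] of_real_eq_0_iff)
  moreover have "0 \<le> of_nat (d choose k) * a k" for k
    using assms(2) by simp
  ultimately have "of_nat (d choose k) * a k = 0"
    using sum_nonneg_eq_0_iff[of "{..d}" "\<lambda>k. of_nat (d choose k) * a k"] assms(3) by blast
  then show ?thesis
    using assms(3) by simp
qed

lemma subgraph_poly_eq_0: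
  assumes "finite V" "\<And>H. H \<subseteq> E \<Longrightarrow> \<exists>v\<in>V. u v (edge_degree ends H v) = 0"
  shows "subgraph_poly V E ends u = 0"
  unfolding subgraph_poly_def
proof (intro sum.neutral ballI)
  fix H assume "H \<in> Pow E"
  then have "(\<Prod>v\<in>V. u v (edge_degree ends H v)) = 0"
    using assms(2)[of H] by (intro prod_zero assms(1)) auto
  then show "Poly_Mapping.single (\<Sum>v\<in>V. Poly_Mapping.single v (edge_degree ends H v))
      (complex_of_real (\<Prod>v\<in>V. u v (edge_degree ends H v))) = 0"
    by (simp only: of_real_0 single_zero)
qed

context finite_multigraph
begin

text \<open>A generating function that is identically zero counts as nonvanishing. In this case
  every subgraph has weight 0, because its degree at \<open>v\<close> is at most
  \<open>D v\<close>.\<close>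

lemma subgraph_poly_vertex_gen_0:
  assumes "\<And>v. v \<in> V \<Longrightarrow> edge_degree ends E v \<le> D v"
    and "\<And>v k. v \<in> V \<Longrightarrow> 0 \<le> u v k"
    and "v \<in> V" "vertex_gen (D v) (u v) = 0"
  shows "subgraph_poly V E ends u = 0"
proof (rule subgraph_poly_eq_0[OF finite_V])
  fix H assume "H \<subseteq> E"
  then have "edge_degree ends H v \<le> D v"
    by (rule order_trans[OF edge_degree_mono[OF finite_E] assms(1)[OF assms(3)]])
  then have "u v (edge_degree ends H v) = 0"
    by (rule vertex_gen_eq_0D[OF assms(4) assms(2)[OF assms(3)]])
  then show "\<exists>v\<in>V. u v (edge_degree ends H v) = 0"
    using assms(3) by blast
qed

section \<open>Discs and their exteriors\<close>

text \<open>The circular region is the closed unit disc, \<open>|x|^2 - 1 \<le> 0\<close>.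
  Multiplication by its points preserves the disc of radius \<open>\<kappa>\<close>, while
  unweighted variables stay in the open unit disc.\<close>

lemma stage_sum_nonzero_disc:
  assumes "\<And>v. v \<in> V \<Longrightarrow> edge_degree ends E v \<le> D v"
    and gen: "\<And>v x. v \<in> V \<Longrightarrow> norm x < \<kappa> \<Longrightarrow> poly (binom_poly (D v) (u v)) x \<noteq> 0"
    and "\<And>v. v \<in> V \<Longrightarrow> norm (z v) < \<kappa>"
  shows "stage_sum V E ends V u z \<noteq> 0"
proof (rule stage_sum_nonzero[where a = 1 and b = 0 and d = "-1" and R = "ball 0 1" and R' = "ball 0 \<kappa>"])
  show "finite_multigraph V E ends" ..
  have C: "circ_form 1 0 (-1) x \<le> 0 \<longleftrightarrow> norm x \<le> 1" for x
    by (simp add: circ_form_def power_le_one_iff abs_square_le_1)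
  show "circ_form 1 0 (-1) 0 \<le> 0"
    by (simp add: C)
  show "circ_form 1 0 (-1) (- 1 / x) \<le> 0" if "x \<notin> ball 0 1" for x
    using that by (simp add: C norm_divide divide_le_eq)
  show "x * y \<noteq> - 1" if "x \<in> ball 0 1" "y \<in> ball 0 1" for x y :: complex
  proof -
    have "norm (x * y) < 1"
      using that mult_strict_mono'[of "norm x" 1 "norm y" 1] by (simp add: norm_mult)
    then show ?thesis by auto
  qed
  show "poly (binom_poly (D v) (u v)) (x * s) \<noteq> 0"
    if "v \<in> V" "x \<in> ball 0 \<kappa>" "circ_form 1 0 (-1) s \<le> 0" for v x s
  proof (rule gen[OF that(1)])
    have "norm (x * s) \<le> norm x"
      using that(3) by (simp add: C norm_mult mult_left_le)
    then show "norm (x * s) < \<kappa>"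
      using that(2) by simp
  qed
qed (use assms in auto)

text \<open>Substituting \<open>E - H\<close> for \<open>H\<close> replaces each degree by its
  difference from the full degree.\<close>

lemma stage_sum_complement:
  assumes "\<And>v. v \<in> V \<Longrightarrow> z v \<noteq> 0"
  shows "stage_sum V E ends V u z =
    (\<Prod>v\<in>V. z v ^ edge_degree ends E v) *
    stage_sum V E ends V (\<lambda>v k. u v (edge_degree ends E v - k)) (\<lambda>v. 1 / z v)"
proof -
  let ?d = "edge_degree ends"
  have le: "?d H v \<le> ?d E v" if "H \<in> Pow E" for H v
    using edge_degree_mono[OF finite_E] that by auto
  have "stage_sum V E ends V u z =
      (\<Sum>H\<in>Pow E. (\<Prod>v\<in>V. u v (?d (E - H) v)) * (\<Prod>v\<in>V. z v ^ ?d (E - H) v))"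
    unfolding stage_sum_def by (rule sum.reindex_bij_witness[of _ "\<lambda>H. E - H" "\<lambda>H. E - H"])
      (auto simp: double_diff)
  also have "\<dots> = (\<Sum>H\<in>Pow E. (\<Prod>v\<in>V. z v ^ ?d E v) *
      ((\<Prod>v\<in>V. u v (?d E v - ?d H v)) * (\<Prod>v\<in>V. (1 / z v) ^ ?d H v)))"
  proof (rule sum.cong[OF refl])
    fix H assume H: "H \<in> Pow E"
    have "(\<Prod>v\<in>V. z v ^ ?d (E - H) v) = (\<Prod>v\<in>V. z v ^ ?d E v * (1 / z v) ^ ?d H v)"
    proof (rule prod.cong[OF refl])
      fix v assume "v \<in> V"
      then show "z v ^ ?d (E - H) v = z v ^ ?d E v * (1 / z v) ^ ?d H v"
        using assms H le[OF H, of v] edge_degree_Diff[OF finite_E, of H ends v]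
        by (simp add: power_diff power_one_over)
    qed
    moreover have "(\<Prod>v\<in>V. u v (?d (E - H) v)) = (\<Prod>v\<in>V. u v (?d E v - ?d H v))"
      using H edge_degree_Diff[OF finite_E, of H ends] by simp
    ultimately show "(\<Prod>v\<in>V. u v (?d (E - H) v)) * (\<Prod>v\<in>V. z v ^ ?d (E - H) v) =
      (\<Prod>v\<in>V. z v ^ ?d E v) * ((\<Prod>v\<in>V. u v (?d E v - ?d H v)) * (\<Prod>v\<in>V. (1 / z v) ^ ?d H v))"
      by (simp only: prod.distrib mult_ac)
  qed
  finally show ?thesis
    by (simp add: stage_sum_def sum_distrib_left)
qed

lemma stage_sum_nonzero_exterior:
  assumes "0 < \<kappa>"
    and top: "\<And>v. v \<in> V \<Longrightarrow> u v (edge_degree ends E v) \<noteq> 0"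
    and gen: "\<And>v x. v \<in> V \<Longrightarrow> \<kappa> < norm x \<Longrightarrow>
                poly (binom_poly (edge_degree ends E v) (u v)) x \<noteq> 0"
    and z: "\<And>v. v \<in> V \<Longrightarrow> \<kappa> < norm (z v)"
  shows "stage_sum V E ends V u z \<noteq> 0"
proof -
  have z0: "z v \<noteq> 0" if "v \<in> V" for v
    using z[OF that] \<open>0 < \<kappa>\<close> by auto
  have "stage_sum V E ends V (\<lambda>v k. u v (edge_degree ends E v - k)) (\<lambda>v. 1 / z v) \<noteq> 0"
  proof (rule stage_sum_nonzero_disc[where \<kappa> = "1 / \<kappa>"])
    show "poly (binom_poly (edge_degree ends E v) (\<lambda>k. u v (edge_degree ends E v - k))) x \<noteq> 0"
      if "v \<in> V" "norm x < 1 / \<kappa>" for v x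
    \<comment> \<open>The point 0 corresponds to infinity; the reversed generating function takes
      there the top weight as its value.\<close>
    proof (cases "x = 0")
      case True
      then show ?thesis
        using top[OF that(1)] by (simp add: poly_0_coeff_0 coeff_binom_poly)
    next
      case False
      then have "\<kappa> < norm (1 / x)"
        using that(2) \<open>0 < \<kappa>\<close> by (simp add: norm_divide field_simps)
      then show ?thesis
        using gen that(1) False by (simp add: poly_binom_poly_reverse)
    qed
    show "norm (1 / z v) < 1 / \<kappa>" if "v \<in> V" for v
      using z[OF that] \<open>0 < \<kappa>\<close> by (simp add: norm_divide frac_less2)
  qed simp
  then show ?thesis
    by (subst stage_sum_complement) (auto simp: z0 finite_V)
qed

end

section \<open>Geometry of sectors\<close>

text \<open>Cosine decreases on \<open>[0, \<pi>]\<close> and \<open>Re z = |z| cos (Arg z)\<close>;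
  at \<open>z = 0\<close> both sides are false.\<close>

lemma sector_iff:
  assumes "0 \<le> \<theta>" "\<theta> \<le> pi"
  shows "z \<in> sector \<theta> \<longleftrightarrow> norm z * cos \<theta> < Re z"
proof (cases "z = 0")
  case False
  have "cos \<theta> < cos \<bar>Arg z\<bar> \<longleftrightarrow> \<bar>Arg z\<bar> < \<theta>"
    using assms Arg_le_pi[of z] mpi_less_Arg[of z] by (intro cos_mono_less_eq) auto
  moreover have "norm z * cos \<bar>Arg z\<bar> = Re z"
    using False by (simp add: cos_Arg)
  ultimately show ?thesis
    using False mult_less_cancel_left_pos[of "norm z" "cos \<theta>" "cos \<bar>Arg z\<bar>"]
    by (simp add: sector_def)
qed (auto simp: sector_def)

lemma open_sector:
  assumes "0 \<le> \<theta>" "\<theta> \<le> pi"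
  shows "open (sector \<theta>)"
proof -
  have "sector \<theta> = {z. norm z * cos \<theta> < Re z}"
    using sector_iff[OF assms] by blast
  then show ?thesis
    by (simp add: open_Collect_less continuous_intros)
qed

text \<open>For \<open>cos \<theta> \<ge> 0\<close> the function
  \<open>|z| cos \<theta> - Re z\<close> is convex.\<close>

lemma convex_sector:
  assumes "0 \<le> \<theta>" "\<theta> \<le> pi / 2"
  shows "convex (sector \<theta>)"
proof (rule convexI)
  fix x y :: complex and s t :: real
  assume xy: "x \<in> sector \<theta>" "y \<in> sector \<theta>" and st: "0 \<le> s" "0 \<le> t" "s + t = 1"
  have c: "0 \<le> cos \<theta>"
    using assms by (intro cos_ge_zero) auto
  have iff: "z \<in> sector \<theta> \<longleftrightarrow> norm z * cos \<theta> < Re z" for z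
    using assms pi_gt_zero by (intro sector_iff) auto
  have "norm (s *\<^sub>R x + t *\<^sub>R y) \<le> s * norm x + t * norm y"
    using st norm_triangle_ineq[of "s *\<^sub>R x" "t *\<^sub>R y"] by simp
  then have "norm (s *\<^sub>R x + t *\<^sub>R y) * cos \<theta> \<le> (s * norm x + t * norm y) * cos \<theta>"
    using c by (rule mult_right_mono)
  also have "\<dots> = s * (norm x * cos \<theta>) + t * (norm y * cos \<theta>)"
    by (simp add: algebra_simps)
  also have "\<dots> < s * Re x + t * Re y"
  proof (cases "s = 0")
    case False
    then show ?thesis
      using st xy unfolding iff
      by (intro add_less_le_mono mult_strict_left_mono mult_left_mono) auto
  qed (use st xy iff in auto)
  finally show "s *\<^sub>R x + t *\<^sub>R y \<in> sector \<theta>"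
    by (simp add: iff)
qed

text \<open>The norm drops by at most \<open>\<epsilon>\<close> while the real part grows by
  \<open>\<epsilon>\<close>; this suffices because \<open>-1 \<le> cos \<theta> \<le> 0\<close>. The
  vertex 0 is included so that shifted generating functions do not vanish there.\<close>

lemma sector_add_pos:
  assumes "pi / 2 \<le> \<theta>" "\<theta> \<le> pi" "z = 0 \<or> z \<in> sector \<theta>" "0 < \<epsilon>"
  shows "z + of_real \<epsilon> \<in> sector \<theta>"
proof (cases "z = 0")
  case True
  then show ?thesis
    using assms pi_gt_zero by (simp add: sector_def, linarith)
next
  case False
  have iff: "z \<in> sector \<theta> \<longleftrightarrow> norm z * cos \<theta> < Re z" for z
    using assms pi_gt_zero by (intro sector_iff) auto
  have "cos \<theta> \<le> cos (pi / 2)"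
    using assms pi_gt_zero by (intro cos_monotone_0_pi_le) auto
  then have c: "cos \<theta> \<le> 0" by simp
  have "norm z - \<epsilon> \<le> norm (z + of_real \<epsilon>)"
    using norm_diff_ineq[of z "of_real \<epsilon>"] assms(4) by simp
  then have "norm (z + of_real \<epsilon>) * cos \<theta> \<le> (norm z - \<epsilon>) * cos \<theta>"
    using c by (rule mult_right_mono_neg)
  also have "\<dots> = norm z * cos \<theta> + \<epsilon> * (- cos \<theta>)"
    by (simp add: algebra_simps)
  also have "\<dots> \<le> norm z * cos \<theta> + \<epsilon> * 1"
    using assms(4) by (intro add_left_mono mult_left_mono) auto
  also have "\<dots> < Re z + \<epsilon>"
    using assms(3) False iff by auto
  finally show ?thesis
    by (simp add: iff)
qed

text \<open>Arguments add without leaving the principal range: \<open>\<pi> - \<alpha>\<close>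
  splits as \<open>(\<pi>/2 - \<alpha>) + \<pi>/2\<close>.\<close>

lemma sector_times_halfplane:
  assumes "\<alpha> < pi / 2" "x \<in> sector (pi / 2 - \<alpha>)" "0 \<le> Re s" "s \<noteq> 0" "0 \<le> \<alpha>"
  shows "x * s \<in> sector (pi - \<alpha>)"
proof -
  have "\<bar>Arg s\<bar> \<le> pi / 2"
    using assms Arg_Re_nonneg by blast
  with assms have "\<bar>Arg x + Arg s\<bar> < pi - \<alpha>"
    by (auto simp: sector_def)
  moreover from this have "Arg (x * s) = Arg x + Arg s"
    using assms by (intro Arg_times) (auto simp: sector_def)
  ultimately show ?thesis
    using assms by (simp add: sector_def)
qed

section \<open>Shifted generating functions and uniform limits\<close>

text \<open>For \<open>j \<le> n\<close> this is \<open>(n - j)! / n!\<close> times the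
  \<open>j\<close>-th derivative of \<open>binom_poly n g\<close> at
  \<open>\<epsilon>\<close>.\<close>

definition shift_coeff :: "real \<Rightarrow> nat \<Rightarrow> (nat \<Rightarrow> complex) \<Rightarrow> nat \<Rightarrow> complex" where
  "shift_coeff \<epsilon> n g j = (\<Sum>i\<le>n - j. of_nat ((n - j) choose i) * g (j + i) * of_real \<epsilon> ^ i)"

lemma shift_coeff_0: "shift_coeff 0 n g j = g j"
  by (simp add: shift_coeff_def sum.atMost_shift)

lemma tendsto_shift_coeff: "((\<lambda>\<epsilon>. shift_coeff \<epsilon> n g j) \<longlongrightarrow> g j) (at 0)"
proof -
  have "((\<lambda>\<epsilon>. shift_coeff \<epsilon> n g j) \<longlongrightarrow> shift_coeff 0 n g j) (at 0)"
    unfolding shift_coeff_def by (intro tendsto_intros)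
  then show ?thesis by (simp add: shift_coeff_0)
qed

text \<open>Expand \<open>(x + \<epsilon>) ^ k\<close>, regroup by powers of \<open>x\<close>, and
  use \<open>(n choose (j + i)) * ((j + i) choose j) = (n choose j) * ((n - j) choose
  i)\<close>.\<close>

lemma binom_poly_shift:
  "poly (binom_poly n (shift_coeff \<epsilon> n g)) x = poly (binom_poly n g) (x + of_real \<epsilon>)"
proof -
  define F where "F j i = of_nat (n choose (j + i)) * of_nat ((j + i) choose j) * g (j + i) *
      (x ^ j * of_real \<epsilon> ^ i)" for j i
  have "poly (binom_poly n g) (x + of_real \<epsilon>) =
      (\<Sum>k\<le>n. of_nat (n choose k) * g k * (\<Sum>j\<le>k. of_nat (k choose j) * x ^ j * of_real \<epsilon> ^ (k - j)))"
    by (simp only: poly_binom_poly binomial_ring)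
  also have "\<dots> = (\<Sum>k\<le>n. \<Sum>j\<le>k. F j (k - j))"
    by (intro sum.cong) (auto simp: F_def sum_distrib_left algebra_simps)
  also have "\<dots> = (\<Sum>(j, i)\<in>{(j, i). j + i \<le> n}. F j i)"
    by (rule sum.triangle_reindex_eq[symmetric])
  also have "{(j, i). j + i \<le> n} = (SIGMA j:{..n}. {..n - j})"
    by auto
  also have "(\<Sum>(j, i)\<in>(SIGMA j:{..n}. {..n - j}). F j i) = (\<Sum>j\<le>n. \<Sum>i\<le>n - j. F j i)"
    by (rule sum.Sigma[symmetric]) auto
  also have "\<dots> = poly (binom_poly n (shift_coeff \<epsilon> n g)) x"
  proof -
    have "(of_nat (n choose (j + i)) * of_nat ((j + i) choose j) :: complex) =
        of_nat (n choose j) * of_nat ((n - j) choose i)" if "j \<le> n" "i \<le> n - j" for i j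
      using choose_mult[of j "j + i" n] that by (simp flip: of_nat_mult)
    then have "F j i = of_nat (n choose j) * (of_nat ((n - j) choose i) * g (j + i) * of_real \<epsilon> ^ i) * x ^ j"
      if "j \<le> n" "i \<le> n - j" for i j
      using that by (simp add: F_def)
    then show ?thesis
      unfolding poly_binom_poly shift_coeff_def sum_distrib_left sum_distrib_right
      by (intro sum.cong refl) simp
  qed
  finally show ?thesis by simp
qed

text \<open>Only the coefficients vary with \<open>n\<close>, so bounds for the
  \<open>\<phi> i\<close> on \<open>K\<close> make the error uniform.\<close>

lemma uniform_limit_weighted_sum:
  fixes c :: "'i \<Rightarrow> nat \<Rightarrow> complex" and \<phi> :: "'i \<Rightarrow> 'a \<Rightarrow> complex"
  assumes "finite I" and c: "\<And>i. i \<in> I \<Longrightarrow> (c i \<longlongrightarrow> c' i) F"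
    and bdd: "\<And>i. i \<in> I \<Longrightarrow> bounded (\<phi> i ` K)"
  shows "uniform_limit K (\<lambda>n t. \<Sum>i\<in>I. c i n * \<phi> i t) (\<lambda>t. \<Sum>i\<in>I. c' i * \<phi> i t) F"
proof (rule uniform_limitI)
  fix e :: real assume e: "0 < e"
  obtain B where B: "\<And>i t. i \<in> I \<Longrightarrow> t \<in> K \<Longrightarrow> norm (\<phi> i t) \<le> B i"
    using bdd by (simp add: bounded_iff) metis
  have "((\<lambda>n. \<Sum>i\<in>I. norm (c i n - c' i) * B i) \<longlongrightarrow> (\<Sum>i\<in>I. norm (c' i - c' i) * B i)) F"
    using c by (intro tendsto_intros)
  then have "\<forall>\<^sub>F n in F. (\<Sum>i\<in>I. norm (c i n - c' i) * B i) < e"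
    using e by (intro order_tendstoD) auto
  then show "\<forall>\<^sub>F n in F. \<forall>t\<in>K. dist (\<Sum>i\<in>I. c i n * \<phi> i t) (\<Sum>i\<in>I. c' i * \<phi> i t) < e"
  proof eventually_elim
    case (elim n)
    show ?case
    proof
      fix t assume t: "t \<in> K"
      have "dist (\<Sum>i\<in>I. c i n * \<phi> i t) (\<Sum>i\<in>I. c' i * \<phi> i t) = norm (\<Sum>i\<in>I. (c i n - c' i) * \<phi> i t)"
        by (simp add: dist_norm sum_subtractf left_diff_distrib)
      also have "\<dots> \<le> (\<Sum>i\<in>I. norm (c i n - c' i) * norm (\<phi> i t))"
        by (rule order_trans[OF norm_sum]) (simp add: norm_mult)
      also have "\<dots> \<le> (\<Sum>i\<in>I. norm (c i n - c' i) * B i)"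
        using B t by (intro sum_mono mult_left_mono) auto
      finally show "dist (\<Sum>i\<in>I. c i n * \<phi> i t) (\<Sum>i\<in>I. c' i * \<phi> i t) < e"
        using elim by simp
    qed
  qed
qed

section \<open>Sectors\<close>

context finite_multigraph
begin

text \<open>The form is \<open>- Re x\<close>, so the circular region is the closed right
  half-plane. As 0 belongs to it, \<open>gen\<close> also covers \<open>x = 0\<close>; adding 0 to
  the open half-plane supplies the point required of \<open>R\<close>.\<close>

lemma stage_sum_nonzero_sector:
  assumes deg: "\<And>v. v \<in> V \<Longrightarrow> edge_degree ends E v \<le> D v"
    and \<alpha>: "0 \<le> \<alpha>" "\<alpha> < pi / 2"
    and gen: "\<And>v x. v \<in> V \<Longrightarrow> x = 0 \<or> x \<in> sector (pi - \<alpha>) \<Longrightarrow> poly (binom_poly (D v) (u v)) x \<noteq> 0"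
    and z: "\<And>v. v \<in> V \<Longrightarrow> z v \<in> sector (pi / 2 - \<alpha>)"
  shows "stage_sum V E ends V u z \<noteq> 0"
proof (rule stage_sum_nonzero[where a = 0 and b = "- (1 / 2)" and d = 0
      and R = "{x. x = 0 \<or> 0 < Re x}" and R' = "sector (pi / 2 - \<alpha>)"])
  show "finite_multigraph V E ends" ..
  have C: "circ_form 0 (- (1 / 2)) 0 x \<le> 0 \<longleftrightarrow> 0 \<le> Re x" for x
    by (simp add: circ_form_def)
  show "circ_form 0 (- (1 / 2)) 0 0 \<le> 0"
    by (simp add: circ_form_def)
  show "circ_form 0 (- (1 / 2)) 0 (- 1 / x) \<le> 0" if "x \<notin> {x. x = 0 \<or> 0 < Re x}" for x
    using that by (simp add: C Re_divide divide_nonpos_nonneg)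
  show "x * y \<noteq> - 1" if "x \<in> {x. x = 0 \<or> 0 < Re x}" "y \<in> {x. x = 0 \<or> 0 < Re x}" for x y :: complex
  proof
    assume xy: "x * y = - 1"
    then have "x \<noteq> 0" "y \<noteq> 0" by auto
    with that have pos: "0 < Re x" "0 < Re y" by auto
    have "y = - 1 / x"
      using xy \<open>x \<noteq> 0\<close> by (simp add: field_simps)
    then have "Re y = - (Re x / ((Re x)\<^sup>2 + (Im x)\<^sup>2))"
      by (simp add: Re_divide)
    moreover have "0 \<le> Re x / ((Re x)\<^sup>2 + (Im x)\<^sup>2)"
      using pos by simp
    ultimately show False
      using pos by linarith
  qed
  show "poly (binom_poly (D v) (u v)) (x * s) \<noteq> 0"
    if "v \<in> V" "x \<in> sector (pi / 2 - \<alpha>)" "circ_form 0 (- (1 / 2)) 0 s \<le> 0" for v x s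
  proof (rule gen[OF that(1)])
    show "x * s = 0 \<or> x * s \<in> sector (pi - \<alpha>)"
      using sector_times_halfplane[OF \<alpha>(2) that(2) _ _ \<alpha>(1), of s] that(3) C by auto
  qed
qed (use deg z in auto)

text \<open>
  The shift \<open>\<Gamma>\<^sub>v(y + \<epsilon>)\<close> does not vanish at \<open>y = 0\<close>; the limit \<open>\<epsilon> \<rightarrow> 0\<close> is taken by Hurwitz's
  theorem along the complex line through \<open>z\<close> and \<open>(1, \<dots>, 1)\<close>, where nonnegativity of the
  weights excludes that the limit vanishes identically.
\<close>

lemma stage_sum_nonzero_sector_nonneg:
  assumes deg: "\<And>v. v \<in> V \<Longrightarrow> edge_degree ends E v \<le> D v"
    and nonneg: "\<And>v k. v \<in> V \<Longrightarrow> 0 \<le> u v k"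
    and \<alpha>: "0 \<le> \<alpha>" "\<alpha> < pi / 2"
    and gen: "\<And>v x. v \<in> V \<Longrightarrow> x \<in> sector (pi - \<alpha>) \<Longrightarrow>
                poly (binom_poly (D v) (\<lambda>k. of_real (u v k))) x \<noteq> 0"
    and H0: "H0 \<subseteq> E" "\<And>v. v \<in> V \<Longrightarrow> u v (edge_degree ends H0 v) \<noteq> 0"
    and z: "\<And>v. v \<in> V \<Longrightarrow> z v \<in> sector (pi / 2 - \<alpha>)"
  shows "stage_sum V E ends V (\<lambda>v k. of_real (u v k)) z \<noteq> 0"
proof
  assume eq0: "stage_sum V E ends V (\<lambda>v k. of_real (u v k)) z = 0"
  \<comment> \<open>An affine path with \<open>w 0 = z\<close> and \<open>w 1\<close> constantly 1;
    \<open>S\<close> holds the parameters that keep all variables in the sector.\<close>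
  define w where "w t v = (1 - t) * z v + t" for t :: complex and v
  define S where "S = {t. \<forall>v\<in>V. w t v \<in> sector (pi / 2 - \<alpha>)}"
  define \<epsilon> where "\<epsilon> n = inverse (real (Suc n))" for n
  define U where "U n v = shift_coeff (\<epsilon> n) (D v) (\<lambda>k. of_real (u v k))" for n v
  define c where "c n H = (\<Prod>v\<in>V. U n v (edge_degree ends H v))" for n H
  define c' where "c' H = (\<Prod>v\<in>V. complex_of_real (u v (edge_degree ends H v)))" for H
  define \<phi> where "\<phi> H t = (\<Prod>v\<in>V. w t v ^ edge_degree ends H v)" for H t
  let ?F = "\<lambda>n t. \<Sum>H\<in>Pow E. c n H * \<phi> H t" and ?g = "\<lambda>t. \<Sum>H\<in>Pow E. c' H * \<phi> H t"
  have hol: "\<phi> H holomorphic_on A" for H A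
    unfolding \<phi>_def w_def by (intro holomorphic_intros)
  have one: "w 1 = (\<lambda>v. 1)" and zero: "w 0 = z"
    by (auto simp: w_def)
  have one_sector: "1 \<in> sector (pi / 2 - \<alpha>)"
    using \<alpha> by (simp add: sector_def)
  have sub: "0 \<in> S" "1 \<in> S"
    using z one_sector by (auto simp: S_def zero one)
  have "?g 0 \<noteq> 0"
  proof (rule Hurwitz_no_zeros[of S ?F ?g 0])
    have "S = (\<Inter>v\<in>V. (\<lambda>t. w t v) -` sector (pi / 2 - \<alpha>))"
      by (auto simp: S_def)
    moreover have "open ((\<lambda>t. w t v) -` sector (pi / 2 - \<alpha>))" for v
      unfolding w_def using \<alpha> by (intro open_vimage open_sector continuous_intros) auto
    ultimately show "open S"
      using finite_V by auto
    \<comment> \<open>\<open>S\<close> is an intersection of preimages of a convex sector under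
      affine maps; Hurwitz's theorem needs it connected.\<close>
    have "convex S"
    proof (rule convexI)
      fix x y :: complex and s t :: real
      assume xy: "x \<in> S" "y \<in> S" and st: "0 \<le> s" "0 \<le> t" "s + t = 1"
      have "w (s *\<^sub>R x + t *\<^sub>R y) v = s *\<^sub>R w x v + t *\<^sub>R w y v" for v
      proof -
        have "s *\<^sub>R w x v + t *\<^sub>R w y v = of_real (s + t) * z v
            + (s *\<^sub>R x + t *\<^sub>R y) - (s *\<^sub>R x + t *\<^sub>R y) * z v"
          by (simp add: w_def scaleR_conv_of_real algebra_simps)
        then show ?thesis
          using st by (simp add: w_def algebra_simps)
      qed
      then show "s *\<^sub>R x + t *\<^sub>R y \<in> S"
        using xy st convexD[OF convex_sector[of "pi / 2 - \<alpha>"]] \<alpha> by (simp add: S_def)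
    qed
    then show "connected S"
      by (rule convex_connected)
    show "?F n holomorphic_on S" for n
      using hol by (intro holomorphic_intros)
    show "?g holomorphic_on S"
      using hol by (intro holomorphic_intros)
    show "uniform_limit K ?F ?g sequentially" if "compact K" for K
    proof (rule uniform_limit_weighted_sum)
      show "finite (Pow E)"
        using finite_E by simp
      have "filterlim \<epsilon> (at 0) sequentially"
        unfolding \<epsilon>_def filterlim_at using LIMSEQ_inverse_real_of_nat by simp
      then have "(\<lambda>n. U n v k) \<longlonglongrightarrow> of_real (u v k)" for v k
        unfolding U_def by (rule filterlim_compose[OF tendsto_shift_coeff])
      then show "(\<lambda>n. c n H) \<longlonglongrightarrow> c' H" for H
        unfolding c_def c'_def by (intro tendsto_prod)
      show "bounded (\<phi> H ` K)" for H
        by (intro compact_imp_bounded compact_continuous_image that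
            holomorphic_on_imp_continuous_on hol)
    qed
    show "?F n t \<noteq> 0" if "t \<in> S" for n t
    proof -
      have "stage_sum V E ends V (U n) (w t) \<noteq> 0"
      proof (rule stage_sum_nonzero_sector[OF deg \<alpha>])
        show "poly (binom_poly (D v) (U n v)) x \<noteq> 0"
          if "v \<in> V" "x = 0 \<or> x \<in> sector (pi - \<alpha>)" for v x
          unfolding U_def binom_poly_shift
          using that \<alpha> by (intro gen sector_add_pos) (auto simp: \<epsilon>_def)
        show "w t v \<in> sector (pi / 2 - \<alpha>)" if "v \<in> V" for v
          using that \<open>t \<in> S\<close> by (simp add: S_def)
      qed
      then show ?thesis
        by (simp add: stage_sum_def c_def \<phi>_def)
    qed
    \<comment> \<open>Since \<open>?g 0 = 0\<close>, constancy would make \<open>?g 1\<close>, the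
      sum of all subgraph weights, vanish, although \<open>H0\<close> has positive weight.\<close>
    show "\<not> ?g constant_on S"
    proof
      assume "?g constant_on S"
      then have "?g 1 = ?g 0"
        using sub unfolding constant_on_def by metis
      also have "?g 0 = 0"
        using eq0 by (simp add: stage_sum_def c'_def \<phi>_def zero)
      also have "?g 1 = of_real (\<Sum>H\<in>Pow E. \<Prod>v\<in>V. u v (edge_degree ends H v))"
        by (simp add: c'_def \<phi>_def one)
      finally have "(\<Sum>H\<in>Pow E. \<Prod>v\<in>V. u v (edge_degree ends H v)) = 0"
        by (simp only: of_real_eq_0_iff)
      then have "(\<Prod>v\<in>V. u v (edge_degree ends H0 v)) = 0"
        using H0(1) nonneg by (subst (asm) sum_nonneg_eq_0_iff) (auto simp: finite_E intro: prod_nonneg)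
      then show False
        using H0(2) by (simp add: prod_zero_iff[OF finite_V])
    qed
    show "0 \<in> S"
      by (rule sub)
  qed
  then show False
    using eq0 by (simp add: stage_sum_def c'_def \<phi>_def zero)
qed

end

theorem theorem17:
  fixes V :: "'v set" and E :: "'e set" and ends :: "'e \<Rightarrow> 'v uprod"
    and D :: "'v \<Rightarrow> nat" and u :: "'v \<Rightarrow> nat \<Rightarrow> real"
  assumes graph: "finite_multigraph V E ends"
    and deg_le: "\<And>v. v \<in> V \<Longrightarrow> edge_degree ends E v \<le> D v"
    and u_nonneg: "\<And>v k. v \<in> V \<Longrightarrow> 0 \<le> u v k"
  shows "(\<forall>\<alpha>::real. 0 \<le> \<alpha> \<and> \<alpha> < pi / 2 \<and>
             (\<forall>v\<in>V. nonvanishing (sector (pi - \<alpha>)) (vertex_gen (D v) (u v))) \<longrightarrow>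
           nonvanishing (sector (pi / 2 - \<alpha>)) (subgraph_poly V E ends u)) \<and>
         (\<forall>\<kappa>::real. 0 < \<kappa> \<and>
             (\<forall>v\<in>V. nonvanishing {z. norm z < \<kappa>} (vertex_gen (D v) (u v))) \<longrightarrow>
           nonvanishing {z. norm z < \<kappa>} (subgraph_poly V E ends u)) \<and>
         (\<forall>\<kappa>::real. 0 < \<kappa> \<and>
             (\<forall>v\<in>V. D v = edge_degree ends E v \<and> u v (D v) \<noteq> 0 \<and>
               nonvanishing {z. norm z > \<kappa>} (vertex_gen (D v) (u v))) \<longrightarrow>
           nonvanishing {z. norm z > \<kappa>} (subgraph_poly V E ends u))"
proof -
  interpret finite_multigraph V E ends by fact
  \<comment> \<open>Both degenerate cases are settled here: a zero subgraph polynomial is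
    nonvanishing by convention, and a zero generating function forces it to be zero.\<close>
  have reduce: "nonvanishing A (subgraph_poly V E ends u)"
    if *: "\<And>z. \<forall>v\<in>V. vertex_gen (D v) (u v) \<noteq> 0 \<Longrightarrow> subgraph_poly V E ends u \<noteq> 0 \<Longrightarrow> \<forall>v. z v \<in> A \<Longrightarrow>
      stage_sum V E ends V (\<lambda>v k. of_real (u v k)) z \<noteq> 0" for A
  proof (cases "subgraph_poly V E ends u = 0")
    case False
    have nz: "\<forall>v\<in>V. vertex_gen (D v) (u v) \<noteq> 0"
    proof (intro ballI notI)
      fix v assume "v \<in> V" "vertex_gen (D v) (u v) = 0"
      then have "subgraph_poly V E ends u = 0"
        using deg_le u_nonneg by (intro subgraph_poly_vertex_gen_0[of D u v]) simp_all
      with False show False by contradiction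
    qed
    show ?thesis
      unfolding nonvanishing_def eval_subgraph_poly_stage[OF finite_V]
      using *[OF nz False] by blast
  qed (simp add: nonvanishing_def)
  show ?thesis
  proof (intro conjI allI impI; elim conjE)
    fix \<alpha> :: real
    assume \<alpha>: "0 \<le> \<alpha>" "\<alpha> < pi / 2"
      and gen: "\<forall>v\<in>V. nonvanishing (sector (pi - \<alpha>)) (vertex_gen (D v) (u v))"
    show "nonvanishing (sector (pi / 2 - \<alpha>)) (subgraph_poly V E ends u)"
    proof (rule reduce)
      fix z :: "'v \<Rightarrow> complex"
      assume nz: "\<forall>v\<in>V. vertex_gen (D v) (u v) \<noteq> 0" "subgraph_poly V E ends u \<noteq> 0"
        and z: "\<forall>v. z v \<in> sector (pi / 2 - \<alpha>)"
      \<comment> \<open>A nonzero polynomial has a subgraph of nonzero weight, the witness against a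
        constant limit.\<close>
      obtain H0 where H0: "H0 \<subseteq> E" "\<forall>v\<in>V. u v (edge_degree ends H0 v) \<noteq> 0"
        using nz(2) subgraph_poly_eq_0[OF finite_V, of E u ends] by blast
      show "stage_sum V E ends V (\<lambda>v k. of_real (u v k)) z \<noteq> 0"
      proof (rule stage_sum_nonzero_sector_nonneg[OF deg_le u_nonneg \<alpha> _ H0(1)])
        show "poly (binom_poly (D v) (\<lambda>k. of_real (u v k))) x \<noteq> 0"
          if "v \<in> V" "x \<in> sector (pi - \<alpha>)" for v x
          using vertex_gen_nonvanishingD[OF _ _ that(2), of "D v" "u v"] gen nz(1) that(1) by simp
      qed (use H0(2) z in auto)
    qed
  next
    fix \<kappa> :: real
    assume "0 < \<kappa>"
      and gen: "\<forall>v\<in>V. nonvanishing {z. norm z < \<kappa>} (vertex_gen (D v) (u v))"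
    show "nonvanishing {z. norm z < \<kappa>} (subgraph_poly V E ends u)"
    proof (rule reduce)
      fix z :: "'v \<Rightarrow> complex"
      assume nz: "\<forall>v\<in>V. vertex_gen (D v) (u v) \<noteq> 0" and z: "\<forall>v. z v \<in> {z. norm z < \<kappa>}"
      show "stage_sum V E ends V (\<lambda>v k. of_real (u v k)) z \<noteq> 0"
      proof (rule stage_sum_nonzero_disc[OF deg_le])
        show "poly (binom_poly (D v) (\<lambda>k. of_real (u v k))) x \<noteq> 0"
          if "v \<in> V" "norm x < \<kappa>" for v x
          using vertex_gen_nonvanishingD[of "{z. norm z < \<kappa>}" "D v" "u v" x] gen nz that by simp
      qed (use z in auto)
    qed
  next
    fix \<kappa> :: real
    assume "0 < \<kappa>"
      and gen: "\<forall>v\<in>V. D v = edge_degree ends E v \<and> u v (D v) \<noteq> 0 \<and>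
        nonvanishing {z. norm z > \<kappa>} (vertex_gen (D v) (u v))"
    show "nonvanishing {z. norm z > \<kappa>} (subgraph_poly V E ends u)"
    proof (rule reduce)
      fix z :: "'v \<Rightarrow> complex"
      assume nz: "\<forall>v\<in>V. vertex_gen (D v) (u v) \<noteq> 0" and z: "\<forall>v. z v \<in> {z. norm z > \<kappa>}"
      show "stage_sum V E ends V (\<lambda>v k. of_real (u v k)) z \<noteq> 0"
      proof (rule stage_sum_nonzero_exterior[OF \<open>0 < \<kappa>\<close>])
        show "of_real (u v (edge_degree ends E v)) \<noteq> (0 :: complex)" if "v \<in> V" for v
          using bspec[OF gen that] by auto
        show "poly (binom_poly (edge_degree ends E v) (\<lambda>k. of_real (u v k))) x \<noteq> 0"
          if "v \<in> V" "\<kappa> < norm x" for v x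
          using vertex_gen_nonvanishingD[of "{z. norm z > \<kappa>}" "D v" "u v" x] bspec[OF gen that(1)] nz that by auto
      qed (use z in auto)
    qed
  qed
qed

end
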